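(* In a space of incidence, the following two statements are equivalent. (Gallucci's axiom) If $a,b,c$ are three pairwise skew lines and $e,f,g$ are three pairwise skew lines such that each of $a,b,c$ meets each of $e,f,g$, then every line $h$ that meets all of $a,b,c$ and every line $d$ that meets all of $e,f,g$ meet each other. (Fundamental theorem of projectivities) A projectivity is determined by the images of three points: if $\phi$ and $\psi$ are two projectivities from (the set of points of) a line $a$ to (the set of points of) a line $b$ and there are three distinct points of $a$ at which $\phi$ and $\psi$ agree, then $\phi=\psi$.
   Context: A space of incidence consists of points, lines and planes with an incidence relation; a line is called incident with a plane if all points of the line are incident with the plane. Points are collinear (coplanar) if they are all incident with one line (one plane). The following axioms hold ("two", "three", etc. mean distinct elements): (S1) Two points uniquely determine a line which is incident with them. (S2) Two planes uniquely determine a line which is incident with them (their line of intersection). (S3) Three non-collinear points uniquely determine a plane incident with them. (S4) Three planes which have no common line uniquely determine a point incident with them. (S5) If two points incident with a line are incident with a plane, then all points of this line are incident with this plane. (S6) If two planes incident with a line are incident with a point, then all planes incident with this line are incident with this point. (S7) In every plane there exist four points, no three of which are collinear. (S8) There exist five points, no four of which are coplanar. Two lines are skew if they do not lie in a common plane. Two lines meet if they have a common point. Given two lines $a$ and $b$ in a plane and a point $P$ of that plane on neither line, the central perspectivity from $a$ to $b$ with center $P$ is the bijection from the points of $a$ to the points of $b$ sending a point $Q$ of $a$ to the intersection point of the line $PQ$ with $b$. A projectivity is a finite product (composition) of central perspectivities $a=a^1\to a^2\to\dots\to a^n=b$; the successive perspectivities may take place in different planes of the space, and $a$, $b$ may be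 skew, coplanar or equal. *)

theory Defs
  imports Main "HOL-Library.FuncSet"
begin

(* Throughout, "two" and "three" objects are distinct objects; this is why
   inequalities appear in the axioms and in meets, skew and perspectivity. *)

locale incidence =
  fixes on_line :: "'point \<Rightarrow> 'line \<Rightarrow> bool" (infix "\<triangleleft>" 50)
    and on_plane :: "'point \<Rightarrow> 'plane \<Rightarrow> bool" (infix "\<sqsubset>" 50)
begin

definition points_on :: "'line \<Rightarrow> 'point set" where
  "points_on l = {P. P \<triangleleft> l}"

definition line_in :: "'line \<Rightarrow> 'plane \<Rightarrow> bool" where
  "line_in l E \<longleftrightarrow> (\<forall>P. P \<triangleleft> l \<longrightarrow> P \<sqsubset> E)"

definition collinear :: "'point set \<Rightarrow> bool" where
  "collinear X \<longleftrightarrow> (\<exists>l. \<forall>P\<in>X. P \<triangleleft> l)"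

definition coplanar :: "'point set \<Rightarrow> bool" where
  "coplanar X \<longleftrightarrow> (\<exists>E. \<forall>P\<in>X. P \<sqsubset> E)"

definition skew :: "'line \<Rightarrow> 'line \<Rightarrow> bool" where
  "skew a b \<longleftrightarrow> a \<noteq> b \<and> \<not> (\<exists>E. line_in a E \<and> line_in b E)"

definition meets :: "'line \<Rightarrow> 'line \<Rightarrow> bool" where
  "meets a b \<longleftrightarrow> a \<noteq> b \<and> (\<exists>P. P \<triangleleft> a \<and> P \<triangleleft> b)"

definition join :: "'point \<Rightarrow> 'point \<Rightarrow> 'line" where
  "join P Q = (THE l. P \<triangleleft> l \<and> Q \<triangleleft> l)"

definition intersection_point :: "'line \<Rightarrow> 'line \<Rightarrow> 'point" where
  "intersection_point a b = (THE P. P \<triangleleft> a \<and> P \<triangleleft> b)"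

(* A map between the point sets of two lines is an extensional function
   (undefined off the points of its source line), so that equality of maps
   is equality of HOL functions. *)

definition perspectivity :: "'line \<Rightarrow> 'line \<Rightarrow> ('point \<Rightarrow> 'point) \<Rightarrow> bool" where
  "perspectivity a b \<phi> \<longleftrightarrow>
     a \<noteq> b \<and>
     (\<exists>E P. line_in a E \<and> line_in b E \<and> P \<sqsubset> E \<and> \<not> P \<triangleleft> a \<and> \<not> P \<triangleleft> b \<and>
        \<phi> = (\<lambda>Q\<in>points_on a. intersection_point (join P Q) b))"

inductive projectivity :: "'line \<Rightarrow> 'line \<Rightarrow> ('point \<Rightarrow> 'point) \<Rightarrow> bool" where
  single: "perspectivity a b \<phi> \<Longrightarrow> projectivity a b \<phi>"
| step: "projectivity a b \<phi> \<Longrightarrow> perspectivity b c \<pi> \<Longrightarrow>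
           projectivity a c (compose (points_on a) \<pi> \<phi>)"

definition gallucci_axiom :: bool where
  "gallucci_axiom \<longleftrightarrow>
     (\<forall>a b c e f g.
        skew a b \<and> skew a c \<and> skew b c \<and>
        skew e f \<and> skew e g \<and> skew f g \<and>
        (\<forall>x\<in>{a, b, c}. \<forall>y\<in>{e, f, g}. meets x y) \<longrightarrow>
        (\<forall>h d. (\<forall>x\<in>{a, b, c}. meets h x) \<and> (\<forall>y\<in>{e, f, g}. meets d y) \<longrightarrow> meets h d))"

definition fundamental_theorem_of_projectivities :: bool where
  "fundamental_theorem_of_projectivities \<longleftrightarrow>
     (\<forall>a b \<phi> \<psi>. projectivity a b \<phi> \<and> projectivity a b \<psi> \<and>
        (\<exists>P Q R. distinct [P, Q, R] \<and> {P, Q, R} \<subseteq> points_on a \<and>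
           \<phi> P = \<psi> P \<and> \<phi> Q = \<psi> Q \<and> \<phi> R = \<psi> R) \<longrightarrow>
        \<phi> = \<psi>)"

end

locale incidence_space = incidence on_line on_plane
  for on_line :: "'point \<Rightarrow> 'line \<Rightarrow> bool" (infix "\<triangleleft>" 50)
    and on_plane :: "'point \<Rightarrow> 'plane \<Rightarrow> bool" (infix "\<sqsubset>" 50) +
  assumes S1: "P \<noteq> Q \<Longrightarrow> \<exists>!l. P \<triangleleft> l \<and> Q \<triangleleft> l"
    and S2: "E \<noteq> F \<Longrightarrow> \<exists>!l. line_in l E \<and> line_in l F"
    and S3: "distinct [P, Q, R] \<Longrightarrow> \<not> collinear {P, Q, R} \<Longrightarrow>
               \<exists>!E. P \<sqsubset> E \<and> Q \<sqsubset> E \<and> R \<sqsubset> E"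
    and S4: "distinct [E, F, G] \<Longrightarrow> \<not> (\<exists>l. line_in l E \<and> line_in l F \<and> line_in l G) \<Longrightarrow>
               \<exists>!P. P \<sqsubset> E \<and> P \<sqsubset> F \<and> P \<sqsubset> G"
    and S5: "P \<noteq> Q \<Longrightarrow> P \<triangleleft> l \<Longrightarrow> Q \<triangleleft> l \<Longrightarrow> P \<sqsubset> E \<Longrightarrow> Q \<sqsubset> E \<Longrightarrow>
               line_in l E"
    and S6: "E \<noteq> F \<Longrightarrow> line_in l E \<Longrightarrow> line_in l F \<Longrightarrow> P \<sqsubset> E \<Longrightarrow> P \<sqsubset> F \<Longrightarrow>
               line_in l G \<Longrightarrow> P \<sqsubset> G"
    and S7: "\<exists>X. card X = 4 \<and> (\<forall>P\<in>X. P \<sqsubset> E) \<and>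
               (\<forall>Y\<subseteq>X. card Y = 3 \<longrightarrow> \<not> collinear Y)"
    and S8: "\<exists>X. card X = 5 \<and> (\<forall>Y\<subseteq>X. card Y = 4 \<longrightarrow> \<not> coplanar Y)"

end

theory Submission
  imports Defs
begin

text \<open>
  For a line \<open>c\<close> skew to \<open>a\<close> and \<open>b\<close>, sending \<open>Q\<close> on \<open>a\<close> to the intersection of \<open>b\<close> with the plane
  through \<open>c\<close> and \<open>Q\<close> is the axis projection from \<open>a\<close> to \<open>b\<close>. Any line through the centre of a
  perspectivity that leaves its plane is an axis inducing it, and conversely an axis
  projection between skew lines is a product of two perspectivities.
  In this language Gallucci's axiom says that two axis projections between skew lines
  coincide as soon as they agree at three points; this gives one implication at once.
  For the converse, Gallucci's axiom allows an axis to be moved along its regulus, and this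
  freedom shows that an axis projection from \<open>a\<close> to \<open>b\<close> followed by a perspectivity from \<open>b\<close> to a
  line skew to \<open>a\<close> is again an axis projection. Hence every projectivity factors through
  some line \<open>z\<close> as two axis projections. If a projectivity of \<open>a\<close> onto itself fixes three points, then its
  two factors, read as maps from \<open>a\<close> to \<open>z\<close>, agree at three points, so they are mutually inverse.
\<close>

section \<open>Lines and planes\<close>

context incidence_space
begin

lemma line_eq: "P \<noteq> Q \<Longrightarrow> P \<triangleleft> l \<Longrightarrow> Q \<triangleleft> l \<Longrightarrow> P \<triangleleft> m \<Longrightarrow> Q \<triangleleft> m \<Longrightarrow> l = m"
  using S1 by blast

lemma line_inD: "line_in l E \<Longrightarrow> P \<triangleleft> l \<Longrightarrow> P \<sqsubset> E"
  by (simp add: line_in_def)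

lemma quadrangle:
  "\<exists>A B C D. distinct [A, B, C, D] \<and> (\<forall>P\<in>{A, B, C, D}. P \<sqsubset> E) \<and>
    (\<forall>l. \<not> (A \<triangleleft> l \<and> B \<triangleleft> l \<and> C \<triangleleft> l) \<and> \<not> (A \<triangleleft> l \<and> B \<triangleleft> l \<and> D \<triangleleft> l) \<and>
      \<not> (A \<triangleleft> l \<and> C \<triangleleft> l \<and> D \<triangleleft> l) \<and> \<not> (B \<triangleleft> l \<and> C \<triangleleft> l \<and> D \<triangleleft> l))"
proof -
  obtain X where X: "card X = 4" "\<forall>P\<in>X. P \<sqsubset> E" "\<forall>Y\<subseteq>X. card Y = 3 \<longrightarrow> \<not> collinear Y"
    using S7 by blast
  obtain A where A: "A \<in> X" using X(1) by fastforce
  have "card (X - {A}) = 3" using X(1) A by simp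
  then obtain B C D where BCD: "X - {A} = {B, C, D}" "B \<noteq> C" "B \<noteq> D" "C \<noteq> D"
    unfolding card_3_iff by blast
  have X_eq: "X = {A, B, C, D}" and dist: "distinct [A, B, C, D]" using A BCD by auto
  have tri: "\<not> (P \<triangleleft> l \<and> Q \<triangleleft> l \<and> R \<triangleleft> l)" if "distinct [P, Q, R]" "{P, Q, R} \<subseteq> X" for P Q R l
    using X(3)[rule_format, of "{P, Q, R}"] that unfolding collinear_def by auto
  show ?thesis
    by (rule exI[of _ A], rule exI[of _ B], rule exI[of _ C], rule exI[of _ D])
      (use X(2) X_eq dist tri[of A B C] tri[of A B D] tri[of A C D] tri[of B C D] in simp)
qed

lemma point_off_line_in_plane: "\<exists>P. P \<sqsubset> E \<and> \<not> P \<triangleleft> l"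
proof -
  obtain A B C where "A \<sqsubset> E" "B \<sqsubset> E" "C \<sqsubset> E" "\<not> (A \<triangleleft> l \<and> B \<triangleleft> l \<and> C \<triangleleft> l)"
    using quadrangle[of E] by (elim exE conjE) auto
  then show ?thesis by blast
qed

lemma point_off_line: "\<exists>P. \<not> P \<triangleleft> l"
  using point_off_line_in_plane by blast

lemma point_off_plane: "\<exists>P. \<not> P \<sqsubset> E"
proof -
  obtain X :: "'point set" where X: "card X = 5" "\<forall>Y\<subseteq>X. card Y = 4 \<longrightarrow> \<not> coplanar Y"
    using S8 by blast
  obtain Y where "Y \<subseteq> X" "card Y = 4"
    using obtain_subset_with_card_n[of 4 X] X(1) by auto
  then show ?thesis using X(2) unfolding coplanar_def by blast
qed

lemma another_point: "\<exists>Q. Q \<noteq> (P :: 'point)"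
proof -
  obtain Q E where "\<not> Q \<sqsubset> E" using point_off_plane by blast
  moreover obtain R where "R \<sqsubset> E" using point_off_line_in_plane by blast
  ultimately show ?thesis by metis
qed

lemma ex_line: "\<exists>l. P \<triangleleft> l \<and> Q \<triangleleft> l"
  using S1 another_point by metis

lemma plane_through_points:
  "P \<noteq> Q \<Longrightarrow> P \<triangleleft> l \<Longrightarrow> Q \<triangleleft> l \<Longrightarrow> \<not> R \<triangleleft> l \<Longrightarrow> \<exists>!E. P \<sqsubset> E \<and> Q \<sqsubset> E \<and> R \<sqsubset> E"
  by (rule S3) (auto simp: collinear_def dest: line_eq)

text \<open>No axiom gives points on a line directly. If \<open>l\<close> had at most one point
  \<open>P\<close>, then \<open>l\<close> would lie in every plane through \<open>P\<close>, in
  particular in two planes through another line \<open>m\<close> through \<open>P\<close>. Then S2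
  forces \<open>l = m\<close>, although \<open>m\<close> has two points.\<close>

lemma two_points: "\<exists>P Q. P \<noteq> Q \<and> P \<triangleleft> l \<and> Q \<triangleleft> l"
proof (rule ccontr)
  assume no: "\<not> ?thesis"
  then obtain P where P: "\<forall>X. X \<triangleleft> l \<longrightarrow> X = P" by metis
  obtain Q where Q: "Q \<noteq> P" using another_point by blast
  obtain m where m: "P \<triangleleft> m" "Q \<triangleleft> m" using ex_line by blast
  obtain R where "\<not> R \<triangleleft> m" using point_off_line by blast
  then obtain E where E: "P \<sqsubset> E" "Q \<sqsubset> E" using plane_through_points m Q by metis
  obtain D where D: "\<not> D \<sqsubset> E" using point_off_plane by blast
  have mE: "line_in m E" using S5 E m Q by blast
  then have "\<not> D \<triangleleft> m" using D line_inD by blast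
  then obtain F where F: "P \<sqsubset> F" "Q \<sqsubset> F" "D \<sqsubset> F" using plane_through_points m Q by metis
  have "line_in m F" using S5 F m Q by blast
  moreover have "line_in l E" "line_in l F" using P E F unfolding line_in_def by auto
  ultimately have "l = m" using S2[of E F] mE D F by blast
  then show False using no m Q by blast
qed

lemma ex_plane: "\<exists>E. line_in l E \<and> P \<sqsubset> E"
proof -
  obtain A B where AB: "A \<noteq> B" "A \<triangleleft> l" "B \<triangleleft> l" using two_points by blast
  have *: "\<exists>E. line_in l E \<and> R \<sqsubset> E" if "\<not> R \<triangleleft> l" for R
    using plane_through_points[OF AB that] S5[OF AB] by blast
  obtain R where "\<not> R \<triangleleft> l" using point_off_line by blast
  then show ?thesis using * line_inD by metis
qed

text \<open>S3 for two points of \<open>l\<close> and the point \<open>P\<close> off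
  \<open>l\<close>.\<close>

lemma plane_eq: 
  assumes "line_in l E" "line_in l F" "\<not> P \<triangleleft> l" "P \<sqsubset> E" "P \<sqsubset> F" 
  shows "E = F"
proof -
  obtain A B where "A \<noteq> B" "A \<triangleleft> l" "B \<triangleleft> l" using two_points by blast
  then show ?thesis using plane_through_points[of A B l P] assms line_inD by metis
qed

lemma line_in_planes_eq: "E \<noteq> F \<Longrightarrow> line_in l E \<Longrightarrow> line_in l F \<Longrightarrow> line_in m E \<Longrightarrow> line_in m F \<Longrightarrow> l = m"
  using S2 by blast

lemma planes_meet:
  assumes "E \<noteq> F"
  obtains l where "line_in l E" "line_in l F" "\<And>P. P \<sqsubset> E \<Longrightarrow> P \<sqsubset> F \<Longrightarrow> P \<triangleleft> l"
  using S2[OF assms] plane_eq assms by metis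

text \<open>Planes \<open>A\<close> and \<open>B\<close> through \<open>a\<close> and
  \<open>b\<close> are raised to a point \<open>D\<close> outside \<open>E\<close>. The only line
  common to \<open>E\<close> and \<open>A\<close> is \<open>a\<close>, the only one common to
  \<open>E\<close> and \<open>B\<close> is \<open>b\<close>, so S4 yields a point of all three
  planes, and it lies on both lines.\<close>

lemma coplanar_lines_meet:
  assumes "line_in a E" "line_in b E"
  shows "\<exists>P. P \<triangleleft> a \<and> P \<triangleleft> b"
proof (cases "a = b")
  case True then show ?thesis using two_points by blast
next
  case False
  obtain D where D: "\<not> D \<sqsubset> E" using point_off_plane by blast
  obtain A where A: "line_in a A" "D \<sqsubset> A" using ex_plane by blast
  obtain B where B: "line_in b B" "D \<sqsubset> B" using ex_plane by blast
  have "A \<noteq> E" "B \<noteq> E" using A B D by auto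
  moreover have "A \<noteq> B" using False assms A B calculation line_in_planes_eq by metis
  moreover have "\<not> (\<exists>l. line_in l E \<and> line_in l A \<and> line_in l B)"
    using False assms A B calculation line_in_planes_eq by metis
  ultimately obtain P where "P \<sqsubset> E" "P \<sqsubset> A" "P \<sqsubset> B" using S4[of E A B] by auto
  then show ?thesis using plane_eq A B assms \<open>A \<noteq> E\<close> \<open>B \<noteq> E\<close> by metis
qed

lemma meeting_lines_coplanar: 
  assumes "P \<triangleleft> a" "P \<triangleleft> b"
  shows "\<exists>E. line_in a E \<and> line_in b E"
proof -
  obtain Q where Q: "Q \<noteq> P" "Q \<triangleleft> b" using two_points by metis
  obtain E where "line_in a E" "Q \<sqsubset> E" using ex_plane by blast
  then show ?thesis using S5 Q assms line_inD by metis
qed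

text \<open>This turns skewness into the absence of a common point, the form used throughout. The
  clause \<open>a \<noteq> b\<close> is absorbed because every line has a point.\<close>

lemma skew_iff: "skew a b \<longleftrightarrow> \<not> (\<exists>P. P \<triangleleft> a \<and> P \<triangleleft> b)"
  unfolding skew_def using coplanar_lines_meet meeting_lines_coplanar two_points by metis

lemma skew_sym: "skew a b \<Longrightarrow> skew b a"
  unfolding skew_iff by blast

lemma line_meets_plane: "\<exists>P. P \<triangleleft> l \<and> P \<sqsubset> E"
proof -
  obtain A where "A \<triangleleft> l" using two_points by blast
  obtain F where F: "line_in l F" using ex_plane by blast
  show ?thesis
  proof (cases "E = F")
    case True then show ?thesis using F \<open>A \<triangleleft> l\<close> line_inD by blast
  next
    case False
    then obtain m where "line_in m E" "line_in m F" using planes_meet by blast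
    then show ?thesis using F coplanar_lines_meet line_inD by metis
  qed
qed

text \<open>Some vertex of a quadrangle in a plane through \<open>l\<close> lies off
  \<open>l\<close>. Projecting the other three vertices from it gives three points of
  \<open>l\<close>, distinct because no three vertices are collinear.\<close>

lemma third_point: "\<exists>R. R \<triangleleft> l \<and> R \<noteq> P \<and> R \<noteq> Q"
proof -
  obtain E where E: "line_in l E" using ex_plane by blast
  have sep: ?thesis if pts: "A \<sqsubset> E" "B \<sqsubset> E" "C \<sqsubset> E" "D \<sqsubset> E" "distinct [A, B, C, D]" "\<not> A \<triangleleft> l"
    and no: "\<And>l. \<not> (A \<triangleleft> l \<and> B \<triangleleft> l \<and> C \<triangleleft> l)" "\<And>l. \<not> (A \<triangleleft> l \<and> B \<triangleleft> l \<and> D \<triangleleft> l)"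
      "\<And>l. \<not> (A \<triangleleft> l \<and> C \<triangleleft> l \<and> D \<triangleleft> l)" for A B C D
  proof -
  have proj: "\<exists>Y m. Y \<triangleleft> l \<and> Y \<triangleleft> m \<and> A \<triangleleft> m \<and> Z \<triangleleft> m" if "Z \<sqsubset> E" "Z \<noteq> A" for Z
  proof -
    obtain m where "A \<triangleleft> m" "Z \<triangleleft> m" using ex_line by blast
    moreover have "line_in m E" using S5 that \<open>A \<sqsubset> E\<close> calculation by metis
    ultimately show ?thesis using coplanar_lines_meet E by metis
  qed
  obtain B' m1 where 1: "B' \<triangleleft> l" "B' \<triangleleft> m1" "A \<triangleleft> m1" "B \<triangleleft> m1" using proj[of B] pts by auto
  obtain C' m2 where 2: "C' \<triangleleft> l" "C' \<triangleleft> m2" "A \<triangleleft> m2" "C \<triangleleft> m2" using proj[of C] pts by auto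
  obtain D' m3 where 3: "D' \<triangleleft> l" "D' \<triangleleft> m3" "A \<triangleleft> m3" "D \<triangleleft> m3" using proj[of D] pts by auto
  have "m1 \<noteq> m2" "m1 \<noteq> m3" "m2 \<noteq> m3" using no 1 2 3 by blast+
  then have "B' \<noteq> C'" "B' \<noteq> D'" "C' \<noteq> D'" using line_eq \<open>\<not> A \<triangleleft> l\<close> 1 2 3 by metis+
  then show ?thesis using 1 2 3 by metis
  qed
  obtain A B C D where q: "distinct [A, B, C, D]" "\<forall>P\<in>{A, B, C, D}. P \<sqsubset> E"
    and tri: "\<forall>l. \<not> (A \<triangleleft> l \<and> B \<triangleleft> l \<and> C \<triangleleft> l) \<and> \<not> (A \<triangleleft> l \<and> B \<triangleleft> l \<and> D \<triangleleft> l) \<and>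
      \<not> (A \<triangleleft> l \<and> C \<triangleleft> l \<and> D \<triangleleft> l) \<and> \<not> (B \<triangleleft> l \<and> C \<triangleleft> l \<and> D \<triangleleft> l)"
    using quadrangle[of E] by (elim exE conjE)
  consider "\<not> A \<triangleleft> l" | "\<not> B \<triangleleft> l" | "\<not> C \<triangleleft> l" using tri by blast
  then show ?thesis
  proof cases
    case 1 then show ?thesis using sep[of A B C D] q tri by simp
  next
    case 2 then show ?thesis using sep[of B A C D] q tri by auto
  next
    case 3 then show ?thesis using sep[of C A B D] q tri by auto
  qed
qed

section \<open>Axis projections\<close>

text \<open>If \<open>c\<close> is skew to \<open>a\<close> and \<open>b\<close>, then on points \<open>Q\<close> of \<open>a\<close> and \<open>S\<close> of \<open>b\<close> this is the graph of the
  axis projection.\<close>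

definition coax :: "'line \<Rightarrow> 'point \<Rightarrow> 'point \<Rightarrow> bool" where
  "coax c Q S \<longleftrightarrow> (\<exists>G. line_in c G \<and> Q \<sqsubset> G \<and> S \<sqsubset> G)"

lemma coax_sym: "coax c Q S \<Longrightarrow> coax c S Q"
  unfolding coax_def by blast

lemma coax_trans: "coax c Q S \<Longrightarrow> coax c S R \<Longrightarrow> \<not> S \<triangleleft> c \<Longrightarrow> coax c Q R"
  unfolding coax_def using plane_eq by metis

lemma coax_ex: "\<exists>S. S \<triangleleft> b \<and> coax c Q S"
  unfolding coax_def using ex_plane line_meets_plane by metis

text \<open>The plane through \<open>c\<close> and \<open>Q\<close> is unique. Two points of
  \<open>b\<close> in it would put \<open>b\<close> in a plane with \<open>c\<close>.\<close>

lemma coax_unique: 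
  assumes "coax c Q S" "coax c Q S'" "S \<triangleleft> b" "S' \<triangleleft> b" "\<not> Q \<triangleleft> c" "skew c b"
  shows "S = S'"
proof -
  obtain G where "line_in c G" "S \<sqsubset> G" "S' \<sqsubset> G"
    using assms plane_eq unfolding coax_def by metis
  then show ?thesis using assms S5 unfolding skew_def by metis
qed

lemma coaxI_meet:
  assumes "Q \<triangleleft> h" "S \<triangleleft> h" "meets h c"
  shows "coax c Q S"
  using assms meeting_lines_coplanar line_inD unfolding coax_def meets_def by metis

lemma coaxD_meet:
  assumes "coax c Q S" "Q \<triangleleft> h" "S \<triangleleft> h" "Q \<noteq> S" "\<not> Q \<triangleleft> c"
  shows "meets h c"
proof -
  obtain G where "line_in c G" "line_in h G" using assms S5 unfolding coax_def by metis
  then show ?thesis using assms coplanar_lines_meet unfolding meets_def by metis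
qed

text \<open>Between points of \<open>E\<close> an axis acts only through its trace \<open>O'\<close>
  in \<open>E\<close>: the plane through \<open>c\<close>, \<open>S\<close> and \<open>U\<close>
  cuts \<open>E\<close> in a line through \<open>O'\<close>, which is coplanar with every other line
  \<open>d\<close> through \<open>O'\<close>.\<close>

lemma coax_change_axis:
  assumes "coax c S U" "S \<sqsubset> E" "U \<sqsubset> E" "O' \<sqsubset> E" "O' \<triangleleft> c" "O' \<triangleleft> d" "\<not> line_in c E"
  shows "coax d S U"
proof -
  obtain G where G: "line_in c G" "S \<sqsubset> G" "U \<sqsubset> G" using assms(1) unfolding coax_def by blast
  then have "G \<noteq> E" using assms by blast
  then obtain k where "\<And>P. P \<sqsubset> G \<Longrightarrow> P \<sqsubset> E \<Longrightarrow> P \<triangleleft> k" using planes_meet by metis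
  then have "S \<triangleleft> k" "U \<triangleleft> k" "O' \<triangleleft> k" using G assms line_inD by blast+
  then show ?thesis using meeting_lines_coplanar assms(6) line_inD unfolding coax_def by metis
qed

lemma skew_through_plane:
  assumes "P \<triangleleft> x" "P \<sqsubset> E" "\<not> P \<triangleleft> a" "line_in a E" "\<not> line_in x E"
  shows "skew x a"
  using assms S5 line_inD unfolding skew_iff by metis

text \<open>If \<open>a\<close> and \<open>d\<close> lay in a plane, each of \<open>e\<close>,
  \<open>f\<close>, \<open>g\<close> would lie in that plane or pass through the common point of
  \<open>a\<close> and \<open>d\<close>. Two of them fall under the same alternative and therefore
  meet.\<close>

lemma transversals_skew:
  assumes "skew e f" "skew e g" "skew f g" "a \<noteq> d"
    and "meets a e" "meets a f" "meets a g" "meets d e" "meets d f" "meets d g"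
  shows "skew a d"
proof (rule ccontr)
  assume "\<not> skew a d"
  then obtain E where E: "line_in a E" "line_in d E" using assms(4) unfolding skew_def by blast
  have *: "line_in m E \<or> (\<exists>P. P \<triangleleft> m \<and> P \<triangleleft> a \<and> P \<triangleleft> d)" if "meets a m" "meets d m" for m
    using that E S5 line_inD unfolding meets_def by metis
  show False
    using *[OF assms(5,8)] *[OF assms(6,9)] *[OF assms(7,10)] assms(1-4) line_eq 
      coplanar_lines_meet unfolding skew_iff by metis
qed

lemma joins_skew:
  assumes "skew a b" "A \<noteq> A'" "B \<noteq> B'" "A \<triangleleft> a" "A' \<triangleleft> a" "B \<triangleleft> b" "B' \<triangleleft> b"
    and "A \<triangleleft> e" "B \<triangleleft> e" "A' \<triangleleft> f" "B' \<triangleleft> f"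
  shows "skew e f"
proof (rule ccontr)
  assume "\<not> skew e f"
  then obtain E where "line_in e E" "line_in f E" 
    using meeting_lines_coplanar unfolding skew_iff by blast
  then have "line_in a E" "line_in b E" using S5 assms line_inD by metis+
  then show False using assms(1) unfolding skew_def by blast
qed

section \<open>Perspectivities and their axes\<close>

lemma join_on: "P \<triangleleft> join P Q \<and> Q \<triangleleft> join P Q" if "P \<noteq> Q"
  unfolding join_def using theI'[OF S1[OF that]] .

lemma intersection_point_on:
  assumes "a \<noteq> b" "P \<triangleleft> a" "P \<triangleleft> b"
  shows "intersection_point a b = P"
  unfolding intersection_point_def using assms line_eq by (intro the_equality) metis+

lemma perspectivity_maps:
  assumes "line_in a E" "line_in b E" "P \<sqsubset> E" "\<not> P \<triangleleft> a" "\<not> P \<triangleleft> b" "Q \<triangleleft> a"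
  defines "R \<equiv> intersection_point (join P Q) b"
  shows "R \<triangleleft> b \<and> R \<triangleleft> join P Q"
proof -
  have PQ: "P \<triangleleft> join P Q" "Q \<triangleleft> join P Q" using join_on assms by metis+
  then have "line_in (join P Q) E" using S5 assms line_inD by metis
  then obtain X where "X \<triangleleft> join P Q" "X \<triangleleft> b" using coplanar_lines_meet assms by metis
  moreover have "join P Q \<noteq> b" using PQ assms by metis
  ultimately show ?thesis unfolding R_def using intersection_point_on by metis
qed

lemma perspectivityE:
  assumes "perspectivity a b \<phi>"
  obtains E P where "a \<noteq> b" "line_in a E" "line_in b E" "P \<sqsubset> E" "\<not> P \<triangleleft> a" "\<not> P \<triangleleft> b"
    and "\<And>Q. Q \<triangleleft> a \<Longrightarrow> \<phi> Q \<triangleleft> b \<and> \<phi> Q \<triangleleft> join P Q"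
proof -
  obtain E P where *: "line_in a E" "line_in b E" "P \<sqsubset> E" "\<not> P \<triangleleft> a" "\<not> P \<triangleleft> b"
    and \<phi>: "\<phi> = (\<lambda>Q\<in>points_on a. intersection_point (join P Q) b)"
    using assms unfolding perspectivity_def by blast
  show ?thesis
  proof (rule that[OF _ *])
    show "a \<noteq> b" using assms unfolding perspectivity_def by blast
  next
    fix Q assume "Q \<triangleleft> a"
    then show "\<phi> Q \<triangleleft> b \<and> \<phi> Q \<triangleleft> join P Q"
      using perspectivity_maps[OF *] by (simp add: \<phi> points_on_def)
  qed
qed

lemma perspectivity_ex:
  assumes "a \<noteq> b" "line_in a E" "line_in b E" "P \<sqsubset> E" "\<not> P \<triangleleft> a" "\<not> P \<triangleleft> b"
  obtains \<phi> where "perspectivity a b \<phi>" "\<And>Q. Q \<triangleleft> a \<Longrightarrow> \<phi> Q \<triangleleft> b \<and> \<phi> Q \<triangleleft> join P Q"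
proof (rule that)
  let ?\<phi> = "\<lambda>Q\<in>points_on a. intersection_point (join P Q) b"
  show "perspectivity a b ?\<phi>" unfolding perspectivity_def using assms by blast
  show "?\<phi> Q \<triangleleft> b \<and> ?\<phi> Q \<triangleleft> join P Q" if "Q \<triangleleft> a" for Q
    using perspectivity_maps[OF assms(2-6)] that by (simp add: points_on_def)
qed

lemma perspectivity_axis:
  assumes "perspectivity a b \<phi>"
  obtains d where "a \<noteq> b" "\<exists>B. B \<triangleleft> a \<and> B \<triangleleft> b" "skew d a" "skew d b"
    "\<And>Q. Q \<triangleleft> a \<Longrightarrow> \<phi> Q \<triangleleft> b \<and> coax d Q (\<phi> Q)"
proof -
  obtain E P where *: "a \<noteq> b" "line_in a E" "line_in b E" "P \<sqsubset> E" "\<not> P \<triangleleft> a" "\<not> P \<triangleleft> b"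
    and \<phi>: "\<And>Q. Q \<triangleleft> a \<Longrightarrow> \<phi> Q \<triangleleft> b \<and> \<phi> Q \<triangleleft> join P Q"
    using perspectivityE[OF assms] by metis
  obtain Y where "\<not> Y \<sqsubset> E" using point_off_plane by blast
  obtain d where d: "P \<triangleleft> d" "Y \<triangleleft> d" using ex_line by blast
  then have dE: "\<not> line_in d E" using \<open>\<not> Y \<sqsubset> E\<close> line_inD by blast
  show ?thesis
  proof (rule that)
    show "a \<noteq> b" by fact
    show "\<exists>B. B \<triangleleft> a \<and> B \<triangleleft> b" using coplanar_lines_meet * by blast
    show "skew d a" "skew d b" using skew_through_plane d dE * by metis+
    fix Q assume Q: "Q \<triangleleft> a"
    have "Q \<triangleleft> join P Q" "P \<triangleleft> join P Q" using join_on Q * by metis+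
    then show "\<phi> Q \<triangleleft> b \<and> coax d Q (\<phi> Q)"
      using \<phi>[OF Q] meeting_lines_coplanar[of P "join P Q" d] d line_inD unfolding coax_def by metis
  qed
qed

text \<open>The intermediate line \<open>m\<close> joins a point \<open>A\<close> of
  \<open>a\<close> to a point \<open>B\<close> of \<open>b\<close> that is not the image
  \<open>A'\<close> of \<open>A\<close>, which makes \<open>m\<close> skew to \<open>c\<close>. The
  centres are the traces of \<open>c\<close> in the planes spanned by \<open>a\<close>,
  \<open>m\<close> and by \<open>m\<close>, \<open>b\<close>.\<close>

lemma axis_projection_projectivity:
  assumes "skew a b" "skew c a" "skew c b"
  obtains \<phi> where "projectivity a b \<phi>" "\<And>Q. Q \<triangleleft> a \<Longrightarrow> \<phi> Q \<triangleleft> b \<and> coax c Q (\<phi> Q)"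
proof -
  obtain A where A: "A \<triangleleft> a" using two_points by blast
  obtain A' where A': "A' \<triangleleft> b" "coax c A A'" using coax_ex by blast
  obtain B where B: "B \<triangleleft> b" "B \<noteq> A'" using third_point by blast
  obtain m where m: "A \<triangleleft> m" "B \<triangleleft> m" using ex_line by blast
  have ncA: "\<not> A \<triangleleft> c" "\<not> B \<triangleleft> c" using A B assms unfolding skew_iff by blast+
  have ma: "m \<noteq> a" "m \<noteq> b" using A B m assms unfolding skew_iff by blast+
  have "\<not> coax c A B" using coax_unique assms A A' B ncA by blast
  then have cm: "skew c m"
    using m meeting_lines_coplanar line_inD unfolding coax_def skew_iff by metis
  obtain E where E: "line_in a E" "line_in m E" using meeting_lines_coplanar A m by blast
  obtain P where P: "P \<triangleleft> c" "P \<sqsubset> E" using line_meets_plane by blast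
  obtain F where F: "line_in m F" "line_in b F" using meeting_lines_coplanar B m by blast
  obtain R where R: "R \<triangleleft> c" "R \<sqsubset> F" using line_meets_plane by blast
  have nP: "\<not> P \<triangleleft> a" "\<not> P \<triangleleft> m" "\<not> R \<triangleleft> m" "\<not> R \<triangleleft> b"
    using P R assms cm unfolding skew_iff by blast+
  obtain \<phi> where \<phi>: "perspectivity a m \<phi>" "\<And>Q. Q \<triangleleft> a \<Longrightarrow> \<phi> Q \<triangleleft> m \<and> \<phi> Q \<triangleleft> join P Q"
    using perspectivity_ex[OF ma(1)[symmetric] E P(2) nP(1,2)] by blast
  obtain \<psi> where \<psi>: "perspectivity m b \<psi>" "\<And>Q. Q \<triangleleft> m \<Longrightarrow> \<psi> Q \<triangleleft> b \<and> \<psi> Q \<triangleleft> join R Q"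
    using perspectivity_ex[OF ma(2) F R(2) nP(3,4)] by blast
  have coax_join: "coax c Q Z" if "X \<triangleleft> c" "Q \<noteq> X" "Z \<triangleleft> join X Q" for X Q Z
    using join_on that meeting_lines_coplanar line_inD unfolding coax_def by metis
  show ?thesis
  proof (rule that)
    show "projectivity a b (compose (points_on a) \<psi> \<phi>)"
      using projectivity.step[OF projectivity.single] \<phi>(1) \<psi>(1) by blast
    fix Q assume Q: "Q \<triangleleft> a"
    have "coax c Q (\<phi> Q)" using coax_join \<phi>(2)[OF Q] P Q nP by metis
    moreover have "coax c (\<phi> Q) (\<psi> (\<phi> Q))" using coax_join \<phi>(2)[OF Q] \<psi>(2) R nP by metis
    moreover have "\<not> \<phi> Q \<triangleleft> c" using \<phi>(2)[OF Q] cm unfolding skew_iff by blast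
    ultimately have "coax c Q (\<psi> (\<phi> Q))" using coax_trans by blast
    then show "compose (points_on a) \<psi> \<phi> Q \<triangleleft> b \<and> coax c Q (compose (points_on a) \<psi> \<phi> Q)"
      using Q \<phi>(2) \<psi>(2) by (simp add: compose_def points_on_def)
  qed
qed

section \<open>The fundamental theorem implies Gallucci's axiom\<close>

lemma meets_sym: "meets a b \<Longrightarrow> meets b a"
  unfolding meets_def by blast

text \<open>Both \<open>c\<close> and \<open>d\<close> serve as axes from \<open>a\<close> to
  \<open>b\<close>, and the two projectivities agree where \<open>a\<close> meets \<open>e\<close>,
  \<open>f\<close>, \<open>g\<close>. Being equal, they also agree where \<open>a\<close> meets
  \<open>h\<close>; as \<open>h\<close> joins this point to its image under \<open>c\<close>, it
  must meet \<open>d\<close>.\<close>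

lemma gallucci_if_fundamental_theorem:
  assumes FT: fundamental_theorem_of_projectivities
  shows gallucci_axiom
proof -
  have "meets h d"
    if sk: "skew a b" "skew a c" "skew b c" "skew e f" "skew e g" "skew f g"
    and m: "meets a e" "meets a f" "meets a g" "meets b e" "meets b f" "meets b g"
      "meets c e" "meets c f" "meets c g" 
    and h: "meets h a" "meets h b" "meets h c" and d: "meets d e" "meets d f" "meets d g"
    for a b c e f g h d
  proof (cases "d \<in> {a, b, c}")
    case True then show ?thesis using h by blast
  next
    case False
    then have dsk: "skew d a" "skew d b" 
      using transversals_skew[OF sk(4-6) _ d m(1-3)] transversals_skew[OF sk(4-6) _ d m(4-6)] by auto
    obtain \<phi> where \<phi>: "projectivity a b \<phi>" "\<And>Q. Q \<triangleleft> a \<Longrightarrow> \<phi> Q \<triangleleft> b \<and> coax c Q (\<phi> Q)"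
      using axis_projection_projectivity[of a b c] sk skew_sym by blast
    obtain \<psi> where \<psi>: "projectivity a b \<psi>" "\<And>Q. Q \<triangleleft> a \<Longrightarrow> \<psi> Q \<triangleleft> b \<and> coax d Q (\<psi> Q)"
      using axis_projection_projectivity[of a b d] sk dsk by blast
    \<comment> \<open>A transversal \<open>l\<close> of \<open>a\<close> and \<open>b\<close> that
      meets the axis \<open>x\<close> joins a point to its image.\<close>
    have val: "\<theta> P = Q" if "P \<triangleleft> a" "P \<triangleleft> l" "Q \<triangleleft> b" "Q \<triangleleft> l" "meets l x" "skew x a" "skew x b"
      "\<And>Q. Q \<triangleleft> a \<Longrightarrow> \<theta> Q \<triangleleft> b \<and> coax x Q (\<theta> Q)" for \<theta> P Q l x
    proof -
      have "\<not> P \<triangleleft> x" using that(1,6) unfolding skew_iff by blast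
      then show ?thesis
        using coax_unique[of x P "\<theta> P" Q b] that coaxI_meet[of P l Q x] by blast
    qed
    have \<phi>_val: "\<phi> P = Q" if "P \<triangleleft> a" "P \<triangleleft> l" "Q \<triangleleft> b" "Q \<triangleleft> l" "meets l c" for P Q l
      using val[OF that] \<phi>(2) sk skew_sym by blast
    have \<psi>_val: "\<psi> P = Q" if "P \<triangleleft> a" "P \<triangleleft> l" "Q \<triangleleft> b" "Q \<triangleleft> l" "meets l d" for P Q l
      using val[OF that] \<psi>(2) dsk by blast
    have agree: "\<exists>P. P \<triangleleft> a \<and> P \<triangleleft> l \<and> \<phi> P = \<psi> P" if "meets a l" "meets b l" "meets c l" "meets d l" for l
      using \<phi>_val \<psi>_val that unfolding meets_def by metis
    obtain P where P: "P \<triangleleft> a" "P \<triangleleft> e" "\<phi> P = \<psi> P" using agree[of e] m d by blast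
    obtain Q where Q: "Q \<triangleleft> a" "Q \<triangleleft> f" "\<phi> Q = \<psi> Q" using agree[of f] m d by blast
    obtain R where R: "R \<triangleleft> a" "R \<triangleleft> g" "\<phi> R = \<psi> R" using agree[of g] m d by blast
    have "distinct [P, Q, R]" "{P, Q, R} \<subseteq> points_on a"
      using sk P Q R unfolding skew_iff points_on_def by auto
    then have eq: "\<phi> = \<psi>"
      using FT[unfolded fundamental_theorem_of_projectivities_def, rule_format, of a b \<phi> \<psi>]
        \<phi>(1) \<psi>(1) P(3) Q(3) R(3) by metis
    obtain X Y where X: "X \<triangleleft> h" "X \<triangleleft> a" and Y: "Y \<triangleleft> h" "Y \<triangleleft> b"
      using h unfolding meets_def by blast
    then have "\<phi> X = Y" using \<phi>_val h by blast
    then have "coax d X Y" using \<psi>(2) eq X by blast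
    moreover have "X \<noteq> Y" "\<not> X \<triangleleft> d" using sk dsk X Y unfolding skew_iff by blast+
    ultimately show ?thesis using coaxD_meet X Y by blast
  qed
  then show ?thesis unfolding gallucci_axiom_def by simp blast
qed

section \<open>Moving an axis along its regulus\<close>

lemma gallucciD:
  assumes gallucci_axiom "skew a b" "skew a c" "skew b c" "skew e f" "skew e g" "skew f g"
    and "meets a e" "meets a f" "meets a g" "meets b e" "meets b f" "meets b g"
      "meets c e" "meets c f" "meets c g" 
    and "meets h a" "meets h b" "meets h c" "meets d e" "meets d f" "meets d g"
  shows "meets h d"
proof -
  have "\<forall>x\<in>{a, b, c}. \<forall>y\<in>{e, f, g}. meets x y" "\<forall>x\<in>{a, b, c}. meets h x"
    "\<forall>y\<in>{e, f, g}. meets d y"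
    using assms by auto
  then show ?thesis using assms(1-7) unfolding gallucci_axiom_def by blast
qed

lemma meetsI: "P \<triangleleft> a \<Longrightarrow> P \<triangleleft> b \<Longrightarrow> a \<noteq> b \<Longrightarrow> meets a b"
  unfolding meets_def by blast

text \<open>Translates pairs related by an axis into transversals of \<open>a\<close>,
  \<open>b\<close>, \<open>c\<close>, the lines that Gallucci's axiom speaks about.\<close>

lemma join_meets:
  assumes "skew a b" "skew c a" "skew c b" "Q \<triangleleft> a" "S \<triangleleft> b" "coax c Q S"
  shows "meets (join Q S) a" "meets (join Q S) b" "meets (join Q S) c"
    "Q \<triangleleft> join Q S" "S \<triangleleft> join Q S"
proof -
  have QS: "Q \<noteq> S" "\<not> Q \<triangleleft> c" "\<not> S \<triangleleft> a" "\<not> Q \<triangleleft> b" using assms unfolding skew_iff by blast+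
  show on: "Q \<triangleleft> join Q S" "S \<triangleleft> join Q S" using join_on QS by auto
  then show "meets (join Q S) a" "meets (join Q S) b"
    using meetsI[OF on(1) assms(4)] meetsI[OF on(2) assms(5)] QS by metis+
  show "meets (join Q S) c" using coaxD_meet[OF assms(6) on] QS by blast
qed

text \<open>An axis projection is injective, so \<open>S\<close> and \<open>S'\<close> differ and
  \<open>joins_skew\<close> applies.\<close>

lemma axis_join_skew:
  assumes "skew a b" "skew c b" "skew c a"
    and "Q \<triangleleft> a" "S \<triangleleft> b" "coax c Q S" "Q' \<triangleleft> a" "S' \<triangleleft> b" "coax c Q' S'" "Q \<noteq> Q'"
    and "Q \<triangleleft> e" "S \<triangleleft> e" "Q' \<triangleleft> f" "S' \<triangleleft> f"
  shows "skew e f"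
proof -
  have "\<not> S \<triangleleft> c" using assms unfolding skew_iff by blast
  then have "S \<noteq> S'" using coax_unique[of c S Q Q' a] coax_sym assms by metis
  then show ?thesis using joins_skew assms by blast
qed

text \<open>Gallucci's axiom with the three joins of \<open>A1\<close>, \<open>A2\<close>,
  \<open>A3\<close> to their images in the roles of \<open>e\<close>, \<open>f\<close>,
  \<open>g\<close>: they are pairwise skew, \<open>d\<close> meets all of them, and the join of
  \<open>Q\<close> and \<open>S\<close> meets \<open>a\<close>, \<open>b\<close>,
  \<open>c\<close>.\<close>

lemma axis_determined:
  assumes G: gallucci_axiom and sk: "skew a b" "skew c a" "skew c b" "skew d a" "skew d b"
    and "distinct [A1, A2, A3]" and A: "A1 \<triangleleft> a" "A2 \<triangleleft> a" "A3 \<triangleleft> a" and B: "B1 \<triangleleft> b" "B2 \<triangleleft> b" "B3 \<triangleleft> b"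
    and c: "coax c A1 B1" "coax c A2 B2" "coax c A3 B3"
    and d: "coax d A1 B1" "coax d A2 B2" "coax d A3 B3"
    and Q: "Q \<triangleleft> a" "S \<triangleleft> b" "coax c Q S"
  shows "coax d Q S"
proof -
  note j = join_meets[OF sk(1-3)] and k = join_meets[OF sk(1,4,5)]
  have e: "skew (join A1 B1) (join A2 B2)" "skew (join A1 B1) (join A3 B3)" "skew (join A2 B2) (join A3 B3)"
    using axis_join_skew[OF sk(1,3,2)] j(4,5) A B c assms(7) by (metis distinct_length_2_or_more)+
  note j1 = j[OF A(1) B(1) c(1)] and j2 = j[OF A(2) B(2) c(2)] and j3 = j[OF A(3) B(3) c(3)]
  note k1 = k[OF A(1) B(1) d(1)] and k2 = k[OF A(2) B(2) d(2)] and k3 = k[OF A(3) B(3) d(3)]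
  have "meets (join Q S) d"
    by (rule gallucciD[OF G sk(1) skew_sym[OF sk(2)] skew_sym[OF sk(3)] e
        j1(1)[THEN meets_sym] j2(1)[THEN meets_sym] j3(1)[THEN meets_sym]
        j1(2)[THEN meets_sym] j2(2)[THEN meets_sym] j3(2)[THEN meets_sym]
        j1(3)[THEN meets_sym] j2(3)[THEN meets_sym] j3(3)[THEN meets_sym] j(1-3)[OF Q]
        k1(3)[THEN meets_sym] k2(3)[THEN meets_sym] k3(3)[THEN meets_sym]])
  then show ?thesis using j(4,5) Q coaxI_meet by blast
qed

text \<open>With two further transversals \<open>f\<close> and \<open>g\<close>, the planes spanned
  by \<open>P\<close> with each of them intersect in a line \<open>d\<close> through
  \<open>P\<close> that meets \<open>t\<close>, \<open>f\<close> and \<open>g\<close>. By Gallucci's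
  axiom every transversal of \<open>a\<close>, \<open>b\<close>, \<open>c\<close> then meets
  \<open>d\<close>.\<close>

lemma axis_through_point:
  assumes G: gallucci_axiom and sk: "skew a b" "skew c a" "skew c b"
    and t: "meets t a" "meets t b" "meets t c" and P: "P \<triangleleft> t" "\<not> P \<triangleleft> a" "\<not> P \<triangleleft> b"
  obtains d where "P \<triangleleft> d" "skew d a" "skew d b"
    and "\<And>Q S. Q \<triangleleft> a \<Longrightarrow> S \<triangleleft> b \<Longrightarrow> coax c Q S \<Longrightarrow> coax d Q S"
proof -
  note j = join_meets[OF sk]
  obtain A B where AB: "A \<triangleleft> a" "A \<triangleleft> t" "B \<triangleleft> b" "B \<triangleleft> t" using t unfolding meets_def by blast
  then have cAB: "coax c A B" using coaxI_meet t by blast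
  obtain A2 where A2: "A2 \<triangleleft> a" "A2 \<noteq> A" using third_point by blast
  obtain A3 where A3: "A3 \<triangleleft> a" "A3 \<noteq> A" "A3 \<noteq> A2" using third_point by blast
  obtain B2 where B2: "B2 \<triangleleft> b" "coax c A2 B2" using coax_ex by blast
  obtain B3 where B3: "B3 \<triangleleft> b" "coax c A3 B3" using coax_ex by blast
  define f where "f = join A2 B2"
  define g where "g = join A3 B3"
  have f: "meets f a" "meets f b" "meets f c" "A2 \<triangleleft> f" "B2 \<triangleleft> f" unfolding f_def using j A2 B2 by auto
  have g: "meets g a" "meets g b" "meets g c" "A3 \<triangleleft> g" "B3 \<triangleleft> g" unfolding g_def using j A3 B3 by auto
  have tfg: "skew t f" "skew t g" "skew f g"
    using axis_join_skew[OF sk(1,3,2)] AB A2 A3 B2 B3 f g cAB by metis+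
  have nP: "\<not> P \<triangleleft> f" "\<not> P \<triangleleft> g" using tfg P unfolding skew_iff by blast+
  obtain F where F: "line_in f F" "P \<sqsubset> F" using ex_plane by blast
  obtain H where H: "line_in g H" "P \<sqsubset> H" using ex_plane by blast
  have "F \<noteq> H" using tfg F H unfolding skew_def by blast
  then obtain d where d: "line_in d F" "line_in d H" "\<And>X. X \<sqsubset> F \<Longrightarrow> X \<sqsubset> H \<Longrightarrow> X \<triangleleft> d"
    using planes_meet by metis
  have Pd: "P \<triangleleft> d" using d F H by blast
  have df: "meets d f" "meets d g" 
    using coplanar_lines_meet[OF d(1) F(1)] coplanar_lines_meet[OF d(2) H(1)] nP Pd 
    unfolding meets_def by auto
  have "d \<noteq> t" using df tfg unfolding meets_def skew_iff by blast
  then have dt: "meets d t" using Pd P meetsI by blast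
  have dsk: "skew d a" "skew d b" 
    using transversals_skew[OF tfg _ dt df] t f g meets_sym Pd P by metis+
  show ?thesis
  proof (rule that[OF Pd dsk])
    fix Q S assume Q: "Q \<triangleleft> a" "S \<triangleleft> b" "coax c Q S"
    have "meets (join Q S) d"
      by (rule gallucciD[OF G sk(1) skew_sym[OF sk(2)] skew_sym[OF sk(3)] tfg
          t(1)[THEN meets_sym] f(1)[THEN meets_sym] g(1)[THEN meets_sym]
          t(2)[THEN meets_sym] f(2)[THEN meets_sym] g(2)[THEN meets_sym]
          t(3)[THEN meets_sym] f(3)[THEN meets_sym] g(3)[THEN meets_sym] j(1-3)[OF Q] dt df])
    then show "coax d Q S" using j(4,5)[OF Q] coaxI_meet by blast
  qed
qed

text \<open>The plane \<open>E\<close> through \<open>b\<close> cuts \<open>a\<close> in \<open>A\<close>. Moving both axes, without changing the maps, so that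
  they meet \<open>E\<close> in the same point \<open>V\<close> allows \<open>b\<close> to be replaced by any line of \<open>E\<close> off \<open>V\<close>, in particular by
  the line \<open>m\<close> joining \<open>A\<close> to \<open>B\<close>. Since \<open>m\<close> meets both \<open>a\<close> and \<open>b'\<close>, the two maps are now perspectivities, and the
  join of their centres \<open>X\<close> and \<open>Y\<close> is a common axis.\<close>

lemma axis_projection_followed_by_perspectivity:
  assumes G: gallucci_axiom and sk: "skew a b" "skew c a" "skew c b" "skew a b'" "skew e b" "skew e b'"
    and B: "b \<noteq> b'" "B \<triangleleft> b" "B \<triangleleft> b'"
  obtains x where "skew x a" "skew x b'"
    and "\<And>Q S R. Q \<triangleleft> a \<Longrightarrow> S \<triangleleft> b \<Longrightarrow> R \<triangleleft> b' \<Longrightarrow> coax c Q S \<Longrightarrow> coax e S R \<Longrightarrow> coax x Q R"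
proof -
  obtain F where F: "line_in b F" "line_in b' F" using meeting_lines_coplanar B by blast
  obtain P where P: "P \<triangleleft> e" "P \<sqsubset> F" using line_meets_plane by blast
  have nP: "\<not> P \<triangleleft> b" "\<not> P \<triangleleft> b'" using P sk unfolding skew_iff by blast+
  have nB: "\<not> B \<triangleleft> c" "\<not> B \<triangleleft> a" using B sk unfolding skew_iff by blast+
  obtain A0 where A0: "A0 \<triangleleft> a" "A0 \<sqsubset> F" using line_meets_plane by blast
  obtain A1 where A1: "A1 \<triangleleft> a" "coax c B A1" using coax_ex by blast
  \<comment> \<open>Avoiding \<open>A0\<close> keeps \<open>A\<close> outside \<open>F\<close>;
    avoiding \<open>A1\<close> keeps \<open>B\<close> from being the image of \<open>A\<close>, so
    the transversal \<open>t\<close> below differs from the line \<open>m\<close> joining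
    \<open>A\<close> and \<open>B\<close>.\<close>
  obtain A where A: "A \<triangleleft> a" "A \<noteq> A0" "A \<noteq> A1" using third_point by blast
  have "\<not> line_in a F" using F sk unfolding skew_def by blast
  then have AF: "\<not> A \<sqsubset> F" using S5 A A0 by metis
  have AB: "\<not> coax c A B" using coax_unique[OF A1(2) _ A1(1) A(1) nB(1) sk(2)] A coax_sym by blast
  have nA: "\<not> A \<triangleleft> b" "\<not> A \<triangleleft> b'" "\<not> A \<triangleleft> c" using A sk unfolding skew_iff by blast+
  obtain E where E: "line_in b E" "A \<sqsubset> E" using ex_plane by blast
  have EF: "E \<noteq> F" using AF E by blast
  obtain T where T: "T \<triangleleft> b" "coax c A T" using coax_ex by blast
  have TB: "T \<noteq> B" using T AB by blast
  define t where "t = join A T"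
  have t: "meets t a" "meets t b" "meets t c" "A \<triangleleft> t" "T \<triangleleft> t"
    unfolding t_def using join_meets[OF sk(1-3) A(1) T] by auto
  obtain V where V: "V \<triangleleft> t" "V \<noteq> A" "V \<noteq> T" using third_point by blast
  have nV: "\<not> V \<triangleleft> a" "\<not> V \<triangleleft> b" using line_eq V A(1) T(1) t unfolding meets_def by metis+
  have VE: "V \<sqsubset> E" using S5[of A T t E] t V E T nA line_inD by metis
  have VF: "\<not> V \<sqsubset> F" using plane_eq[of b E F V] nV VE EF E F by blast
  obtain c' where c': "V \<triangleleft> c'" "skew c' a" "skew c' b"
    and cc': "\<And>Q S. Q \<triangleleft> a \<Longrightarrow> S \<triangleleft> b \<Longrightarrow> coax c Q S \<Longrightarrow> coax c' Q S"
    using axis_through_point[OF G sk(1-3) t(1-3) V(1) nV] by metis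
  \<comment> \<open>\<open>d\<close> passes through the trace \<open>P\<close> of \<open>e\<close>
    in \<open>F\<close> and the trace \<open>V\<close> of \<open>c'\<close> in \<open>E\<close>. It
    can therefore replace \<open>e\<close> between \<open>b\<close> and \<open>b'\<close>, and
    \<open>c'\<close> between \<open>b\<close> and \<open>m\<close>.\<close>
  obtain d where d: "P \<triangleleft> d" "V \<triangleleft> d" using ex_line by blast
  obtain m where m: "A \<triangleleft> m" "B \<triangleleft> m" using ex_line by blast
  have Vm: "\<not> V \<triangleleft> m" using line_eq V A(1) T(1) t m TB B nA by metis
  have mE: "line_in m E" using S5[of A B m E] m E B nA line_inD by metis
  have dF: "\<not> line_in d F" using VF d line_inD by blast
  have "\<not> P \<sqsubset> E" using plane_eq[of b E F P] nP P EF E F by blast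
  then have dE: "\<not> line_in d E" using d line_inD by blast
  have c'E: "\<not> line_in c' E" using c'(3) E unfolding skew_def by blast
  have db: "skew d b" "skew d b'" using skew_through_plane d P nP F dF by metis+
  have dm: "skew d m" "skew c' m" using skew_through_plane d c' VE Vm mE dE c'E by metis+
  obtain H where H: "line_in a H" "line_in m H" using meeting_lines_coplanar A m by blast
  obtain K where K: "line_in m K" "line_in b' K" using meeting_lines_coplanar B m by blast
  have HK: "H \<noteq> K" using H K sk unfolding skew_def by blast
  obtain X where X: "X \<triangleleft> c'" "X \<sqsubset> H" using line_meets_plane by blast
  obtain Y where Y: "Y \<triangleleft> d" "Y \<sqsubset> K" using line_meets_plane by blast
  have nX: "\<not> X \<triangleleft> a" "\<not> X \<triangleleft> m" "\<not> Y \<triangleleft> m" "\<not> Y \<triangleleft> b'" 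
    using X Y c' dm db unfolding skew_iff by blast+
  have XK: "\<not> X \<sqsubset> K" "\<not> Y \<sqsubset> H" using plane_eq[of m H K] H K X Y nX HK by metis+
  obtain x where x: "X \<triangleleft> x" "Y \<triangleleft> x" using ex_line by blast
  have xH: "\<not> line_in x H" "\<not> line_in x K" using XK x line_inD by blast+
  have xa: "skew x a" "skew x b'" "skew x m"
    using skew_through_plane x X Y H K nX xH by metis+
  have c'H: "\<not> line_in c' H" "\<not> line_in d K" using H K c' db unfolding skew_def by metis+
  show ?thesis
  proof (rule that[OF xa(1,2)])
    fix Q S R assume Q: "Q \<triangleleft> a" and S: "S \<triangleleft> b" and R: "R \<triangleleft> b'" and QS: "coax c Q S" and SR: "coax e S R"
    have eF: "\<not> line_in e F" using sk F unfolding skew_def by blast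
    have dSR: "coax d S R"
      using coax_change_axis[OF SR, of F P d] S R F P d eF line_inD by blast
    \<comment> \<open>\<open>U\<close> is the image of \<open>S\<close> on \<open>m\<close>.
      Eliminating \<open>S\<close> leaves \<open>Q\<close> and \<open>U\<close> related by
      \<open>c'\<close>, and \<open>U\<close> and \<open>R\<close> related by \<open>d\<close>; both
      relations then pass to \<open>x\<close>.\<close>
    obtain U where U: "U \<triangleleft> m" "coax c' S U" using coax_ex by blast
    have dSU: "coax d S U"
      using coax_change_axis[OF U(2), of E V d] S U E mE c' d c'E VE line_inD by blast
    have "\<not> S \<triangleleft> c'" "\<not> S \<triangleleft> d" "\<not> U \<triangleleft> x" using S U c' db xa unfolding skew_iff by blast+
    then have QU: "coax c' Q U" and UR: "coax d U R"
      using coax_trans cc'[OF Q S QS] U dSU dSR coax_sym by blast+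
    have "coax x Q U"
      using coax_change_axis[OF QU, of H X x] Q U H X x c'H line_inD by blast
    moreover have "coax x U R"
      using coax_change_axis[OF UR, of K Y x] R U K Y x c'H line_inD by blast
    ultimately show "coax x Q R" using coax_trans \<open>\<not> U \<triangleleft> x\<close> by blast
  qed
qed

text \<open>A line joining a point off \<open>E\<close> to a point off \<open>F\<close> meets each
  plane only once and has a third point.\<close>

lemma point_off_two_planes: "\<exists>Y. \<not> Y \<sqsubset> E \<and> \<not> Y \<sqsubset> F"
proof -
  obtain A where A: "\<not> A \<sqsubset> E" using point_off_plane by blast
  obtain B where B: "\<not> B \<sqsubset> F" using point_off_plane by blast
  obtain l where l: "A \<triangleleft> l" "B \<triangleleft> l" using ex_line by blast
  have "\<not> line_in l E" "\<not> line_in l F" using A B l line_inD by blast+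
  moreover obtain P where P: "P \<triangleleft> l" "P \<sqsubset> E" using line_meets_plane by blast
  moreover obtain Q where Q: "Q \<triangleleft> l" "Q \<sqsubset> F" using line_meets_plane by blast
  moreover obtain R where "R \<triangleleft> l" "R \<noteq> P" "R \<noteq> Q" using third_point by blast
  ultimately show ?thesis using S5 by metis
qed

section \<open>Reduction of projectivities to two axis projections\<close>

text \<open>With only three points on a line the fundamental theorem is trivial. Four points on every line
  guarantee a line through a given point that is skew to three given lines.\<close>

definition at_least_four_points :: "'line \<Rightarrow> bool" where
  "at_least_four_points l \<longleftrightarrow> (\<forall>P Q R. \<exists>S. S \<triangleleft> l \<and> S \<notin> {P, Q, R})"

text \<open>A perspectivity from \<open>l\<close> to \<open>m\<close>, with a centre
  \<open>V\<close> on a line joining a point of \<open>l\<close> to a point of \<open>m\<close>,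
  transports the points.\<close>

lemma four_points_meeting:
  assumes l: "at_least_four_points l" and B: "B \<triangleleft> l" "B \<triangleleft> m"
  shows "at_least_four_points m"
proof (cases "l = m")
  case True then show ?thesis using l by simp
next
  case False
  obtain E where E: "line_in l E" "line_in m E" using meeting_lines_coplanar B by blast
  obtain L where L: "L \<triangleleft> l" "L \<noteq> B" using third_point by blast
  obtain M where M: "M \<triangleleft> m" "M \<noteq> B" using third_point by blast
  have LM: "\<not> L \<triangleleft> m" "\<not> M \<triangleleft> l" using line_eq L M B False by metis+
  obtain k where k: "L \<triangleleft> k" "M \<triangleleft> k" using ex_line by blast
  obtain V where V: "V \<triangleleft> k" "V \<noteq> L" "V \<noteq> M" using third_point by blast
  have nV: "\<not> V \<triangleleft> l" "\<not> V \<triangleleft> m" using line_eq V L(1) M(1) k LM by metis+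
  have kE: "line_in k E" using S5 k L(1) M(1) LM E line_inD by metis
  have VE: "V \<sqsubset> E" using kE V line_inD by blast
  have proj: "\<exists>Y n. Y \<triangleleft> p \<and> Y \<triangleleft> n \<and> V \<triangleleft> n \<and> X \<triangleleft> n" 
    if "X \<sqsubset> E" "X \<noteq> V" "line_in p E" for X p
  proof -
    obtain n where n: "V \<triangleleft> n" "X \<triangleleft> n" using ex_line by blast
    then have "line_in n E" using S5 that VE by metis
    then show ?thesis using coplanar_lines_meet that n by metis
  qed
  \<comment> \<open>At most one point of \<open>l\<close> projects from \<open>V\<close> to
    \<open>P\<close>, so avoiding three points of \<open>m\<close> reduces to avoiding three points
    of \<open>l\<close>.\<close>
  have inv: "\<exists>Y. \<forall>Z n. Z \<triangleleft> l \<longrightarrow> Z \<triangleleft> n \<longrightarrow> V \<triangleleft> n \<longrightarrow> P \<triangleleft> n \<longrightarrow> P \<triangleleft> m \<longrightarrow> Z = Y" for P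
    using line_eq nV by metis
  show ?thesis unfolding at_least_four_points_def
  proof (intro allI)
    fix P Q R
    obtain P' where P': "\<And>Z n. Z \<triangleleft> l \<Longrightarrow> Z \<triangleleft> n \<Longrightarrow> V \<triangleleft> n \<Longrightarrow> P \<triangleleft> n \<Longrightarrow> P \<triangleleft> m \<Longrightarrow> Z = P'"
      using inv[of P] by blast
    obtain Q' where Q': "\<And>Z n. Z \<triangleleft> l \<Longrightarrow> Z \<triangleleft> n \<Longrightarrow> V \<triangleleft> n \<Longrightarrow> Q \<triangleleft> n \<Longrightarrow> Q \<triangleleft> m \<Longrightarrow> Z = Q'"
      using inv[of Q] by blast
    obtain R' where R': "\<And>Z n. Z \<triangleleft> l \<Longrightarrow> Z \<triangleleft> n \<Longrightarrow> V \<triangleleft> n \<Longrightarrow> R \<triangleleft> n \<Longrightarrow> R \<triangleleft> m \<Longrightarrow> Z = R'"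
      using inv[of R] by blast
    obtain Z where Z: "Z \<triangleleft> l" "Z \<notin> {P', Q', R'}" using l unfolding at_least_four_points_def by blast
    have "Z \<sqsubset> E" "Z \<noteq> V" using Z E nV line_inD by blast+
    then obtain S n where "S \<triangleleft> m" "S \<triangleleft> n" "V \<triangleleft> n" "Z \<triangleleft> n" using proj E by blast
    then show "\<exists>S. S \<triangleleft> m \<and> S \<notin> {P, Q, R}" using P' Q' R' Z by blast
  qed
qed

lemma four_points_all:
  assumes "at_least_four_points l"
  shows "at_least_four_points m"
proof -
  obtain P where P: "P \<triangleleft> l" using two_points by blast
  obtain Q where Q: "Q \<triangleleft> m" using two_points by blast
  obtain k where "P \<triangleleft> k" "Q \<triangleleft> k" using ex_line by blast
  then show ?thesis using four_points_meeting P Q assms by blast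
qed

text \<open>The joining line now meets three planes once each, hence the call for a fourth
  point.\<close>

lemma point_off_three_planes:
  assumes four: "\<And>l. at_least_four_points l"
  shows "\<exists>Y. \<not> Y \<sqsubset> E \<and> \<not> Y \<sqsubset> F \<and> \<not> Y \<sqsubset> H"
proof -
  obtain A where A: "\<not> A \<sqsubset> E" "\<not> A \<sqsubset> F" using point_off_two_planes by blast
  obtain B where B: "\<not> B \<sqsubset> H" using point_off_plane by blast
  obtain l where l: "A \<triangleleft> l" "B \<triangleleft> l" using ex_line by blast
  have nl: "\<not> line_in l E" "\<not> line_in l F" "\<not> line_in l H" using A B l line_inD by blast+
  obtain P where P: "P \<triangleleft> l" "P \<sqsubset> E" using line_meets_plane by blast
  obtain Q where Q: "Q \<triangleleft> l" "Q \<sqsubset> F" using line_meets_plane by blast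
  obtain R where R: "R \<triangleleft> l" "R \<sqsubset> H" using line_meets_plane by blast
  obtain S where S: "S \<triangleleft> l" "S \<notin> {P, Q, R}" using four unfolding at_least_four_points_def by blast
  then have "\<not> S \<sqsubset> E" "\<not> S \<sqsubset> F" "\<not> S \<sqsubset> H" using S5 nl P Q R by blast+
  then show ?thesis by blast
qed

text \<open>Take \<open>W\<close> on neither line and leave the planes joining \<open>W\<close> to
  \<open>a\<close> and to \<open>b\<close>. Only two planes are avoided, so three points on a line
  suffice.\<close>

lemma skew_to_two_lines: "\<exists>c. skew c a \<and> skew c b"
proof -
  obtain E where E: "line_in a E" using ex_plane by blast
  obtain F where F: "line_in b F" using ex_plane by blast
  obtain W where W: "\<not> W \<sqsubset> E" "\<not> W \<sqsubset> F" using point_off_two_planes by blast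
  obtain H where H: "line_in a H" "W \<sqsubset> H" using ex_plane by blast
  obtain K where K: "line_in b K" "W \<sqsubset> K" using ex_plane by blast
  obtain Y where Y: "\<not> Y \<sqsubset> H" "\<not> Y \<sqsubset> K" using point_off_two_planes by blast
  obtain c where c: "W \<triangleleft> c" "Y \<triangleleft> c" using ex_line by blast
  have "\<not> line_in c H" "\<not> line_in c K" "\<not> W \<triangleleft> a" "\<not> W \<triangleleft> b" using c Y W E F line_inD by blast+
  then show ?thesis using skew_through_plane[OF c(1) H(2) _ H(1)]
      skew_through_plane[OF c(1) K(2) _ K(1)] by blast
qed

lemma skew_line_through:
  assumes four: "\<And>l. at_least_four_points l" and P: "\<not> P \<triangleleft> a" "\<not> P \<triangleleft> b" "\<not> P \<triangleleft> c"
  shows "\<exists>z. P \<triangleleft> z \<and> skew z a \<and> skew z b \<and> skew z c"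
proof -
  obtain E where E: "line_in a E" "P \<sqsubset> E" using ex_plane by blast
  obtain F where F: "line_in b F" "P \<sqsubset> F" using ex_plane by blast
  obtain H where H: "line_in c H" "P \<sqsubset> H" using ex_plane by blast
  obtain Y where Y: "\<not> Y \<sqsubset> E" "\<not> Y \<sqsubset> F" "\<not> Y \<sqsubset> H" using point_off_three_planes[OF four] by blast
  obtain z where z: "P \<triangleleft> z" "Y \<triangleleft> z" using ex_line by blast
  have "\<not> line_in z E" "\<not> line_in z F" "\<not> line_in z H" using z Y line_inD by blast+
  then show ?thesis using z(1) skew_through_plane[OF z(1) E(2) P(1) E(1)]
      skew_through_plane[OF z(1) F(2) P(2) F(1)] skew_through_plane[OF z(1) H(2) P(3) H(1)] by blast
qed

text \<open>The map goes from \<open>a\<close> to \<open>z\<close> with axis \<open>c\<close>, then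
  from \<open>z\<close> to \<open>b\<close> with axis \<open>x\<close>. The middle line is a
  parameter because it has to be exchanged, and \<open>\<phi>\<close> is constrained only on points
  of \<open>a\<close>, so it need not be extensional.\<close>

definition two_axis_form :: "'line \<Rightarrow> 'line \<Rightarrow> 'line \<Rightarrow> ('point \<Rightarrow> 'point) \<Rightarrow> bool" where
  "two_axis_form z a b \<phi> \<longleftrightarrow> skew z a \<and> skew z b \<and>
     (\<exists>c x. skew c a \<and> skew c z \<and> skew x z \<and> skew x b \<and>
       (\<forall>Q. Q \<triangleleft> a \<longrightarrow> \<phi> Q \<triangleleft> b \<and> (\<exists>Z. Z \<triangleleft> z \<and> coax c Q Z \<and> coax x Z (\<phi> Q))))"

text \<open>Going to \<open>z\<close> and back along the same axis; this starts the induction in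
  \<open>two_axis_form_ex\<close>.\<close>

lemma two_axis_form_id:
  assumes "skew z a"
  shows "two_axis_form z a a (\<lambda>Q. Q)"
proof -
  obtain c where c: "skew c a" "skew c z" using skew_to_two_lines by blast
  have "\<exists>Z. Z \<triangleleft> z \<and> coax c Q Z \<and> coax c Z Q" for Q
    using coax_ex[of z c Q] coax_sym by blast
  then show ?thesis unfolding two_axis_form_def using assms c skew_sym by blast
qed

text \<open>A projection from \<open>z\<close> to \<open>z'\<close> with axis \<open>e\<close> and
  its inverse are inserted between the two factors. Each factor, read as a map into
  \<open>z\<close>, absorbs its neighbour by
  \<open>axis_projection_followed_by_perspectivity\<close>.\<close>

lemma two_axis_form_change_middle:
  assumes G: gallucci_axiom and N: "two_axis_form z a b \<phi>"
    and z': "skew z' a" "skew z' b" "z \<noteq> z'" "P \<triangleleft> z" "P \<triangleleft> z'"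
  shows "two_axis_form z' a b \<phi>"
proof -
  obtain c x where sk: "skew z a" "skew z b" "skew c a" "skew c z" "skew x z" "skew x b"
    and N': "\<And>Q. Q \<triangleleft> a \<Longrightarrow> \<phi> Q \<triangleleft> b \<and> (\<exists>Z. Z \<triangleleft> z \<and> coax c Q Z \<and> coax x Z (\<phi> Q))"
    using N unfolding two_axis_form_def by blast
  obtain e where e: "skew e z" "skew e z'" using skew_to_two_lines by blast
  obtain c' where c': "skew c' a" "skew c' z'"
    "\<And>Q S R. Q \<triangleleft> a \<Longrightarrow> S \<triangleleft> z \<Longrightarrow> R \<triangleleft> z' \<Longrightarrow> coax c Q S \<Longrightarrow> coax e S R \<Longrightarrow> coax c' Q R"
    using axis_projection_followed_by_perspectivity[OF G skew_sym[OF sk(1)] sk(3,4) skew_sym[OF z'(1)] e z'(3-5)] by blast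
  obtain x' where x': "skew x' b" "skew x' z'"
    "\<And>Q S R. Q \<triangleleft> b \<Longrightarrow> S \<triangleleft> z \<Longrightarrow> R \<triangleleft> z' \<Longrightarrow> coax x Q S \<Longrightarrow> coax e S R \<Longrightarrow> coax x' Q R"
    using axis_projection_followed_by_perspectivity[OF G skew_sym[OF sk(2)] sk(6,5) skew_sym[OF z'(2)] e z'(3-5)] by blast
  have "\<phi> Q \<triangleleft> b \<and> (\<exists>Z. Z \<triangleleft> z' \<and> coax c' Q Z \<and> coax x' Z (\<phi> Q))" if Q: "Q \<triangleleft> a" for Q
  proof -
    obtain Z where Z: "\<phi> Q \<triangleleft> b" "Z \<triangleleft> z" "coax c Q Z" "coax x Z (\<phi> Q)" using N'[OF Q] by blast
    obtain R where R: "R \<triangleleft> z'" "coax e Z R" using coax_ex by blast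
    have "coax c' Q R" using c'(3) Q Z R by blast
    moreover have "coax x' (\<phi> Q) R" using x'(3) Z R coax_sym by blast
    ultimately show ?thesis using coax_sym Z R by blast
  qed
  then show ?thesis unfolding two_axis_form_def using z' c' x' by blast
qed

text \<open>If the middle line is skew to \<open>b'\<close>, the second factor absorbs the new map.
  Otherwise the middle line is first turned about one of its points off \<open>b'\<close> into a
  line that is also skew to \<open>b'\<close>.\<close>

lemma two_axis_form_step:
  assumes G: gallucci_axiom and four: "\<And>l. at_least_four_points l"
    and N: "two_axis_form z a b \<phi>" and b: "b \<noteq> b'" "B \<triangleleft> b" "B \<triangleleft> b'" and e: "skew e b" "skew e b'"
    and \<psi>: "\<And>Q. Q \<triangleleft> a \<Longrightarrow> \<psi> Q \<triangleleft> b' \<and> coax e (\<phi> Q) (\<psi> Q)"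
  shows "\<exists>z. two_axis_form z a b' \<psi>"
proof -
  have main: "two_axis_form w a b' \<psi>" if w: "two_axis_form w a b \<phi>" "skew w b'" for w
  proof -
    obtain c x where sk: "skew w a" "skew w b" "skew c a" "skew c w" "skew x w" "skew x b"
      and w': "\<And>Q. Q \<triangleleft> a \<Longrightarrow> \<phi> Q \<triangleleft> b \<and> (\<exists>Z. Z \<triangleleft> w \<and> coax c Q Z \<and> coax x Z (\<phi> Q))"
      using w unfolding two_axis_form_def by blast
    obtain x' where x': "skew x' w" "skew x' b'"
      "\<And>Q S R. Q \<triangleleft> w \<Longrightarrow> S \<triangleleft> b \<Longrightarrow> R \<triangleleft> b' \<Longrightarrow> coax x Q S \<Longrightarrow> coax e S R \<Longrightarrow> coax x' Q R"
      using axis_projection_followed_by_perspectivity[OF G sk(2,5,6) w(2) e b] by blast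
    have "\<psi> Q \<triangleleft> b' \<and> (\<exists>Z. Z \<triangleleft> w \<and> coax c Q Z \<and> coax x' Z (\<psi> Q))" if "Q \<triangleleft> a" for Q
      using w' \<psi> x'(3) that by blast
    then show ?thesis unfolding two_axis_form_def using sk w(2) x' by blast
  qed
  show ?thesis
  proof (cases "skew z b'")
    case True then show ?thesis using main N by blast
  next
    case False
    have sk: "skew z a" "skew z b" using N unfolding two_axis_form_def by blast+
    then have "z \<noteq> b'" using b unfolding skew_iff by blast
    then obtain P where P: "P \<triangleleft> z" "\<not> P \<triangleleft> b'" using two_points line_eq by metis
    have nP: "\<not> P \<triangleleft> a" "\<not> P \<triangleleft> b" using P sk unfolding skew_iff by blast+
    obtain w where w: "P \<triangleleft> w" "skew w a" "skew w b" "skew w b'"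
      using skew_line_through[OF four nP P(2)] by blast
    have "z \<noteq> w" using w(4) False by blast
    then show ?thesis using main two_axis_form_change_middle[OF G N w(2,3) _ P(1) w(1)] w(4) by blast
  qed
qed

section \<open>Two-axis forms of projectivities and their quotients\<close>

lemma projectivity_maps: "projectivity a b \<phi> \<Longrightarrow> Q \<triangleleft> a \<Longrightarrow> \<phi> Q \<triangleleft> b"
proof (induction arbitrary: Q rule: projectivity.induct)
  case (single a b \<phi>) then show ?case by (metis perspectivityE)
next
  case (step a b \<phi> c \<pi>)
  then have "\<phi> Q \<triangleleft> b" by blast
  then have "\<pi> (\<phi> Q) \<triangleleft> c" using step(2) by (metis perspectivityE)
  then show ?case using step(4) by (simp add: compose_def points_on_def)
qed

lemma perspectivity_inj:
  assumes "perspectivity a b \<phi>" "Q \<triangleleft> a" "R \<triangleleft> a" "\<phi> Q = \<phi> R"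
  shows "Q = R"
proof -
  obtain d where d: "skew d a" "skew d b" "\<And>Q. Q \<triangleleft> a \<Longrightarrow> \<phi> Q \<triangleleft> b \<and> coax d Q (\<phi> Q)"
    using perspectivity_axis[OF assms(1)] by metis
  have "\<not> \<phi> Q \<triangleleft> d" using d assms(2) unfolding skew_iff by blast
  then show ?thesis using coax_unique[of d "\<phi> Q" Q R a] coax_sym d assms(2-4) by metis
qed

lemma projectivity_inj: "projectivity a b \<phi> \<Longrightarrow> Q \<triangleleft> a \<Longrightarrow> R \<triangleleft> a \<Longrightarrow> \<phi> Q = \<phi> R \<Longrightarrow> Q = R"
proof (induction arbitrary: Q R rule: projectivity.induct)
  case (single a b \<phi>) then show ?case using perspectivity_inj by blast
next
  case (step a b \<phi> c \<pi>)
  have "\<phi> Q \<triangleleft> b" "\<phi> R \<triangleleft> b" using projectivity_maps step by blast+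
  moreover have "\<pi> (\<phi> Q) = \<pi> (\<phi> R)" using step by (simp add: compose_def points_on_def)
  ultimately show ?case using perspectivity_inj step by metis
qed

lemma two_axis_form_ex:
  assumes G: gallucci_axiom and four: "\<And>l. at_least_four_points l" 
  shows "projectivity a b \<phi> \<Longrightarrow> \<exists>z. two_axis_form z a b \<phi>"
proof (induction rule: projectivity.induct)
  case (single a b \<phi>)
  obtain d where d: "a \<noteq> b" "\<exists>B. B \<triangleleft> a \<and> B \<triangleleft> b" "skew d a" "skew d b"
    "\<And>Q. Q \<triangleleft> a \<Longrightarrow> \<phi> Q \<triangleleft> b \<and> coax d Q (\<phi> Q)" using perspectivity_axis[OF single] by metis
  obtain z where "skew z a" using skew_to_two_lines by blast
  then have "two_axis_form z a a (\<lambda>Q. Q)" by (rule two_axis_form_id)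
  then show ?case using two_axis_form_step[OF G four _ d(1) _ _ d(3,4) d(5)] d(2) by blast
next
  case (step a b \<phi> c \<pi>)
  obtain d where d: "b \<noteq> c" "\<exists>B. B \<triangleleft> b \<and> B \<triangleleft> c" "skew d b" "skew d c"
    "\<And>Q. Q \<triangleleft> b \<Longrightarrow> \<pi> Q \<triangleleft> c \<and> coax d Q (\<pi> Q)" using perspectivity_axis[OF step(2)] by metis
  have "compose (points_on a) \<pi> \<phi> Q \<triangleleft> c \<and> coax d (\<phi> Q) (compose (points_on a) \<pi> \<phi> Q)" if "Q \<triangleleft> a" for Q
    using d(5)[OF projectivity_maps[OF step(1) that]] that by (simp add: compose_def points_on_def)
  then show ?case using two_axis_form_step[OF G four _ d(1) _ _ d(3,4)] d(2) step(3) by metis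
qed

text \<open>The axis of \<open>\<pi>\<close> also induces the inverse map from \<open>c\<close> to
  \<open>b\<close>, so \<open>\<chi>\<close> arises from \<open>\<phi>\<close> by one more
  \<open>two_axis_form_step\<close>.\<close>

lemma two_axis_form_perspectivity_preimage:
  assumes G: gallucci_axiom and four: "\<And>l. at_least_four_points l"
    and N: "two_axis_form z a c \<phi>" and \<pi>: "perspectivity b c \<pi>"
  shows "\<exists>z \<chi>. two_axis_form z a b \<chi> \<and> (\<forall>Q. Q \<triangleleft> a \<longrightarrow> \<pi> (\<chi> Q) = \<phi> Q)"
proof -
  obtain d where d: "b \<noteq> c" "\<exists>B. B \<triangleleft> b \<and> B \<triangleleft> c" "skew d b" "skew d c"
    "\<And>Q. Q \<triangleleft> b \<Longrightarrow> \<pi> Q \<triangleleft> c \<and> coax d Q (\<pi> Q)" using perspectivity_axis[OF \<pi>] by metis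
  have "\<forall>Q. \<exists>S. S \<triangleleft> b \<and> coax d (\<phi> Q) S" using coax_ex by blast
  then obtain \<chi> where \<chi>: "\<And>Q. \<chi> Q \<triangleleft> b \<and> coax d (\<phi> Q) (\<chi> Q)" by metis
  have "\<exists>z. two_axis_form z a b \<chi>"
    using two_axis_form_step[OF G four N d(1)[symmetric] _ _ d(4,3) \<chi>] d(2) by blast
  moreover have "\<pi> (\<chi> Q) = \<phi> Q" if "Q \<triangleleft> a" for Q
  proof -
    have "\<phi> Q \<triangleleft> c" using N that unfolding two_axis_form_def by blast
    moreover have "\<not> \<chi> Q \<triangleleft> d" using \<chi> d(3) unfolding skew_iff by blast
    ultimately show ?thesis using coax_unique[of d "\<chi> Q" _ _ c] coax_sym \<chi> d(4,5) by metis
  qed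
  ultimately show ?thesis by blast
qed

text \<open>In effect this composes with the inverse of \<open>\<psi>\<close>.\<close>

lemma two_axis_form_preimage:
  assumes G: gallucci_axiom and four: "\<And>l. at_least_four_points l"
  shows "projectivity b c \<psi> \<Longrightarrow> two_axis_form z a c \<phi> \<Longrightarrow>
    \<exists>z \<chi>. two_axis_form z a b \<chi> \<and> (\<forall>Q. Q \<triangleleft> a \<longrightarrow> \<psi> (\<chi> Q) = \<phi> Q)"
proof (induction arbitrary: z \<phi> rule: projectivity.induct)
  case (single b c \<psi>) then show ?case using two_axis_form_perspectivity_preimage[OF G four] by blast
next
  case (step b c \<psi> d \<pi>)
  \<comment> \<open>The last perspectivity is undone first; the induction hypothesis undoes the
    rest.\<close>
  obtain w \<chi> where \<chi>: "two_axis_form w a c \<chi>" "\<And>Q. Q \<triangleleft> a \<Longrightarrow> \<pi> (\<chi> Q) = \<phi> Q"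
    using two_axis_form_perspectivity_preimage[OF G four step(4,2)] by blast
  obtain v \<theta> where \<theta>: "two_axis_form v a b \<theta>" "\<And>Q. Q \<triangleleft> a \<Longrightarrow> \<psi> (\<theta> Q) = \<chi> Q"
    using step(3)[OF \<chi>(1)] by blast
  have "compose (points_on b) \<pi> \<psi> (\<theta> Q) = \<phi> Q" if "Q \<triangleleft> a" for Q
  proof -
    have "\<theta> Q \<triangleleft> b" using \<theta>(1) that unfolding two_axis_form_def by blast
    then show ?thesis using \<theta>(2) \<chi>(2) that by (simp add: compose_def points_on_def)
  qed
  then show ?case using \<theta>(1) by blast
qed

text \<open>At a fixed point both axes pair the point with the same point of \<open>z\<close>. By
  \<open>axis_determined\<close> the axis \<open>x\<close> then relates \<open>Q\<close> to its
  intermediate image \<open>Z\<close>, and \<open>Z\<close> has only one partner on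
  \<open>a\<close>.\<close>

lemma two_axis_form_fixing_three_points:
  assumes G: gallucci_axiom and N: "two_axis_form z a a \<phi>"
    and dist: "distinct [A1, A2, A3]" and A: "A1 \<triangleleft> a" "A2 \<triangleleft> a" "A3 \<triangleleft> a"
    and fix_A: "\<phi> A1 = A1" "\<phi> A2 = A2" "\<phi> A3 = A3" and Q: "Q \<triangleleft> a"
  shows "\<phi> Q = Q"
proof -
  obtain c x where sk: "skew z a" "skew c a" "skew c z" "skew x z" "skew x a"
    and N': "\<And>Q. Q \<triangleleft> a \<Longrightarrow> \<phi> Q \<triangleleft> a \<and> (\<exists>Z. Z \<triangleleft> z \<and> coax c Q Z \<and> coax x Z (\<phi> Q))"
    using N unfolding two_axis_form_def by blast
  obtain B1 where B1: "B1 \<triangleleft> z" "coax c A1 B1" "coax x A1 B1" using N'[OF A(1)] fix_A coax_sym by metis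
  obtain B2 where B2: "B2 \<triangleleft> z" "coax c A2 B2" "coax x A2 B2" using N'[OF A(2)] fix_A coax_sym by metis
  obtain B3 where B3: "B3 \<triangleleft> z" "coax c A3 B3" "coax x A3 B3" using N'[OF A(3)] fix_A coax_sym by metis
  obtain Z where Z: "Z \<triangleleft> z" "coax c Q Z" "coax x Z (\<phi> Q)" "\<phi> Q \<triangleleft> a" using N'[OF Q] by blast
  have "coax x Q Z"
    by (rule axis_determined[OF G skew_sym[OF sk(1)] sk(2,3,5,4) dist A B1(1) B2(1) B3(1)
        B1(2) B2(2) B3(2) B1(3) B2(3) B3(3) Q Z(1,2)])
  moreover have "\<not> Z \<triangleleft> x" using Z sk unfolding skew_iff by blast
  ultimately show ?thesis using coax_unique[of x Z _ _ a] coax_sym Z Q sk(5) by metis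
qed

section \<open>Gallucci's axiom implies the fundamental theorem\<close>

lemma projectivity_extensional: "projectivity a b \<phi> \<Longrightarrow> \<phi> \<in> extensional (points_on a)"
  by (induction rule: projectivity.induct) (auto simp: perspectivity_def)

lemma fundamental_theorem_if_gallucci:
  assumes G: gallucci_axiom
  shows fundamental_theorem_of_projectivities
proof -
  have "\<phi> = \<psi>" if \<phi>: "projectivity a b \<phi>" and \<psi>: "projectivity a b \<psi>"
    and dist: "distinct [P, Q, R]" and on: "P \<triangleleft> a" "Q \<triangleleft> a" "R \<triangleleft> a"
    and eq: "\<phi> P = \<psi> P" "\<phi> Q = \<psi> Q" "\<phi> R = \<psi> R" for a b \<phi> \<psi> P Q R
  proof -
    have "\<phi> X = \<psi> X" if X: "X \<triangleleft> a" for X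
    proof (cases "at_least_four_points a")
      case True
      then have four: "\<And>l. at_least_four_points l" using four_points_all by blast
      obtain z where "two_axis_form z a b \<phi>" using two_axis_form_ex[OF G four \<phi>] by blast
      \<comment> \<open>\<open>\<chi>\<close> plays the role of the inverse of \<open>\<psi>\<close>
        after \<open>\<phi>\<close>; since \<open>\<psi>\<close> is injective, it fixes every point
        where \<open>\<phi>\<close> and \<open>\<psi>\<close> agree.\<close>
      then obtain w \<chi> where \<chi>: "two_axis_form w a a \<chi>" "\<And>Q. Q \<triangleleft> a \<Longrightarrow> \<psi> (\<chi> Q) = \<phi> Q"
        using two_axis_form_preimage[OF G four \<psi>] by blast
      have "\<chi> Y = Y" if "Y \<triangleleft> a" "\<phi> Y = \<psi> Y" for Y
      proof (rule projectivity_inj[OF \<psi>])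
        show "\<chi> Y \<triangleleft> a" using \<chi>(1) that unfolding two_axis_form_def by blast
        show "Y \<triangleleft> a" "\<psi> (\<chi> Y) = \<psi> Y" using \<chi>(2) that by auto
      qed
      then have "\<chi> X = X"
        using two_axis_form_fixing_three_points[OF G \<chi>(1) dist on] on eq X by blast
      then show ?thesis using \<chi>(2) X by metis
    next
      case False
      \<comment> \<open>Here \<open>P\<close>, \<open>Q\<close>, \<open>R\<close> exhaust the points
        of \<open>a\<close>.\<close>
      then obtain A B C where "\<And>S. S \<triangleleft> a \<Longrightarrow> S \<in> {A, B, C}"
        unfolding at_least_four_points_def by blast
      from this[OF X] this[OF on(1)] this[OF on(2)] this[OF on(3)] show ?thesis
        using dist eq by auto
    qed
    then show ?thesis
      using extensionalityI[OF projectivity_extensional[OF \<phi>] projectivity_extensional[OF \<psi>]]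
      by (simp add: points_on_def)
  qed
  then show ?thesis
    unfolding fundamental_theorem_of_projectivities_def points_on_def by (simp, blast)
qed

end

theorem mainTheorem3:
  fixes on_line :: "'point \<Rightarrow> 'line \<Rightarrow> bool"
    and on_plane :: "'point \<Rightarrow> 'plane \<Rightarrow> bool"
  assumes "incidence_space on_line on_plane"
  shows "incidence.gallucci_axiom on_line on_plane \<longleftrightarrow>
         incidence.fundamental_theorem_of_projectivities on_line on_plane"
proof -
  interpret incidence_space on_line on_plane by (fact assms)
  show ?thesis using gallucci_if_fundamental_theorem fundamental_theorem_if_gallucci by blast
qed

end
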